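(* Let $X$ be a coverable uniform space. The following are equivalent: (1) $X$ is universal. (2) For every entourage $E$ such that $X_E$ is chain connected, $\delta_E(X)$ is trivial (i.e., every $E$-loop based at $*$ is $E$-homotopic to the trivial loop). (3) $\delta_1(X)$ is trivial.
   Context: All entourages are taken to be symmetric. Fix a basepoint $*\in X$. For an entourage $E$ of a uniform space $X$, an $E$-chain from $p$ to $q$ is a finite sequence $\{x_0=p,\dots,x_n=q\}$ with $(x_i,x_{i+1})\in E$ for all $i$; it is an $E$-loop if $p=q$. Two $E$-chains with the same endpoints are $E$-homotopic if one is obtained from the other in finitely many steps, each adding or removing a single point, always keeping the endpoints fixed and keeping an $E$-chain at each stage (in particular $\{p\}$ and $\{p,p\}$ are $E$-homotopic); $[\alpha]_E$ is the class of $\alpha$. $X_E$ is the set of $E$-homotopy classes of $E$-chains starting at $*$. For an entourage $D\subset E$ let $D^*$ be the set of pairs $([*=x_0,\dots,x_n,y]_E,[*=x_0,\dots,x_n,z]_E)$ with $(y,z)\in D$; $X_E$ carries the uniformity with base $\{D^*:D\subset E\}$. The endpoint map is $\phi_{XE}:X_E\to X$, and for $D\subset E$, $\phi_{ED}:X_D\to X_E$ is $[\alpha]_D\mapsto[\alpha]_E$. $\widetilde{X}=\varprojlim X_E$ (over all entourages, ordered by reverse inclusion, with the inverse limit uniformity), with projections $\phi_E:\widetilde{X}\to X_E$. $X$ is coverable if its uniformity has a base, containing $X\times X$, of entourages $E$ for which $\phi_E$ is surjective. $X$ is universal if its uniformity has a base $\mathcal{U}$ such that for every $E\in\mathcal{U}$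 the map $\phi_{XE}:X_E\to X$ is a uniform homeomorphism. $\delta_E(X)$ is the group of $E$-homotopy classes of $E$-loops at $*$ under concatenation, and $\delta_1(X)=\varprojlim\delta_E(X)$, with bonding maps $[\lambda]_F\mapsto[\lambda]_E$ for $F\subset E$. A uniform space is chain connected if every uniformly continuous function from it to a discrete uniform space is constant (equivalently, for every entourage $F$ every pair of points is joined by an $F$-chain). *)

theory Defs
  imports Complex_Main "HOL-Library.FuncSet" "HOL-Algebra.Product_Groups"
begin

section \<open>Uniform structures on a carrier\<close>

text \<open>
  The space X is a type of class \<^class>\<open>uniform_space\<close> (so X is nonempty, but need not be
  Hausdorff). The spaces of classes of chains depend on an entourage and are therefore carrier sets
  A together with a filter U on pairs, the filter being concentrated on A x A. All entourages are
  symmetric.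
\<close>

definition entourages_on :: "'b set \<Rightarrow> ('b \<times> 'b) filter \<Rightarrow> ('b \<times> 'b) set set" where
  "entourages_on A U = {E. E \<subseteq> A \<times> A \<and> sym E \<and> eventually (\<lambda>p. p \<in> E) U}"

abbreviation entourages :: "('a::uniform_space \<times> 'a) set set" where
  "entourages \<equiv> entourages_on UNIV uniformity"

definition entourage_base :: "('a::uniform_space \<times> 'a) set set \<Rightarrow> bool" where
  "entourage_base B \<longleftrightarrow> B \<subseteq> entourages \<and> (\<forall>E\<in>entourages. \<exists>D\<in>B. D \<subseteq> E)"

definition uniformly_continuous_map ::
    "'b set \<Rightarrow> ('b \<times> 'b) filter \<Rightarrow> 'c set \<Rightarrow> ('c \<times> 'c) filter \<Rightarrow> ('b \<Rightarrow> 'c) \<Rightarrow> bool" where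
  "uniformly_continuous_map A U B V f \<longleftrightarrow>
     f ` A \<subseteq> B \<and> filterlim (\<lambda>(x, y). (f x, f y)) V U"

definition uniform_homeomorphism ::
    "'b set \<Rightarrow> ('b \<times> 'b) filter \<Rightarrow> 'c set \<Rightarrow> ('c \<times> 'c) filter \<Rightarrow> ('b \<Rightarrow> 'c) \<Rightarrow> bool" where
  "uniform_homeomorphism A U B V f \<longleftrightarrow>
     bij_betw f A B \<and> uniformly_continuous_map A U B V f
       \<and> uniformly_continuous_map B V A U (inv_into A f)"


section \<open>Chains and homotopies\<close>

definition echain :: "('b \<times> 'b) set \<Rightarrow> 'b list \<Rightarrow> bool" where
  "echain E xs \<longleftrightarrow> xs \<noteq> [] \<and> successively (\<lambda>x y. (x, y) \<in> E) xs"

definition chain_connected :: "'b set \<Rightarrow> ('b \<times> 'b) filter \<Rightarrow> bool" where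
  "chain_connected A U \<longleftrightarrow>
     (\<forall>F\<in>entourages_on A U. \<forall>p\<in>A. \<forall>q\<in>A. \<exists>xs. echain F xs \<and> hd xs = p \<and> last xs = q)"

text \<open>
  The formulation by maps to discrete spaces quantifies over all target types, which a definition
  cannot do; the two lemmas below show that it is equivalent (the two-element discrete space
  suffices in the converse direction).
\<close>

lemma chain_connected_imp_constant:
  fixes f :: "'b \<Rightarrow> 'c"
  assumes "U \<le> principal (A \<times> A)" and "chain_connected A U"
    and "uniformly_continuous_map A U C (principal Id) f" and "p \<in> A" and "q \<in> A"
  shows "f p = f q"
proof -
  define F where "F = {(x, y). x \<in> A \<and> y \<in> A \<and> f x = f y}"
  have "eventually (\<lambda>p. p \<in> A \<times> A) U"
    using assms(1) by (simp add: le_principal)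
  moreover have "eventually (\<lambda>(x, y). f x = f y) U"
    using assms(3) by (simp add: uniformly_continuous_map_def filterlim_principal case_prod_beta')
  ultimately have "eventually (\<lambda>p. p \<in> F) U"
    by eventually_elim (auto simp: F_def)
  then have "F \<in> entourages_on A U"
    by (auto simp: entourages_on_def F_def sym_def)
  then obtain xs where "echain F xs" "hd xs = p" "last xs = q"
    using assms(2,4,5) unfolding chain_connected_def by blast
  moreover have "echain F xs \<Longrightarrow> f (hd xs) = f (last xs)" for xs
    by (induction xs) (auto simp: echain_def successively_Cons F_def)
  ultimately show ?thesis by auto
qed

lemma chain_connectedI_constant:
  assumes "\<And>(f :: 'b \<Rightarrow> bool) p q. uniformly_continuous_map A U UNIV (principal Id) f
             \<Longrightarrow> p \<in> A \<Longrightarrow> q \<in> A \<Longrightarrow> f p = f q"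
  shows "chain_connected A U"
  unfolding chain_connected_def
proof (intro ballI)
  fix F p q assume F: "F \<in> entourages_on A U" and p: "p \<in> A" and q: "q \<in> A"
  define f where "f y \<longleftrightarrow> (\<exists>xs. echain F xs \<and> hd xs = p \<and> last xs = y)" for y
  have step: "f z" if yz: "(y, z) \<in> F" and y: "f y" for y z
  proof -
    obtain xs where "echain F xs" "hd xs = p" "last xs = y"
      using y by (auto simp: f_def)
    then have "echain F (xs @ [z]) \<and> hd (xs @ [z]) = p \<and> last (xs @ [z]) = z"
      using yz by (auto simp: echain_def successively_append_iff)
    then show ?thesis unfolding f_def by blast
  qed
  have "eventually (\<lambda>p. p \<in> F) U" "sym F"
    using F by (auto simp: entourages_on_def)
  then have "eventually (\<lambda>(x, y). f x = f y) U"
    by (auto elim!: eventually_mono simp: sym_def intro: step)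
  then have "uniformly_continuous_map A U UNIV (principal Id) f"
    by (simp add: uniformly_continuous_map_def filterlim_principal case_prod_beta')
  then have "f p = f q"
    using assms p q by blast
  moreover have "f p"
    unfolding f_def by (rule exI[of _ "[p]"]) (simp add: echain_def)
  ultimately show "\<exists>xs. echain F xs \<and> hd xs = p \<and> last xs = q"
    by (simp add: f_def)
qed

text \<open>One point is added, possibly next to an equal end point.\<close>

definition add_point :: "('b \<times> 'b) set \<Rightarrow> 'b list \<Rightarrow> 'b list \<Rightarrow> bool" where
  "add_point E xs ys \<longleftrightarrow>
     echain E xs \<and> echain E ys \<and> hd ys = hd xs \<and> last ys = last xs
       \<and> (\<exists>us w vs. xs = us @ vs \<and> ys = us @ w # vs)"

definition homotopic :: "('b \<times> 'b) set \<Rightarrow> 'b list \<Rightarrow> 'b list \<Rightarrow> bool" where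
  "homotopic E = equivclp (add_point E)"

definition hclass :: "('b \<times> 'b) set \<Rightarrow> 'b list \<Rightarrow> 'b list set" where
  "hclass E xs = {ys. homotopic E xs ys}"

lemma homotopic_refl [simp]: "homotopic E xs xs"
  by (simp add: homotopic_def)

lemma homotopic_sym: "homotopic E xs ys \<Longrightarrow> homotopic E ys xs"
  unfolding homotopic_def by (rule equivclp_sym)

lemma homotopic_trans [trans]: "homotopic E xs ys \<Longrightarrow> homotopic E ys zs \<Longrightarrow> homotopic E xs zs"
  unfolding homotopic_def by (meson transpD transp_equivclp)

lemma add_point_homotopic: "add_point E xs ys \<Longrightarrow> homotopic E xs ys"
  unfolding homotopic_def by (rule r_into_equivclp)

lemma hclass_eq_iff: "hclass E xs = hclass E ys \<longleftrightarrow> homotopic E xs ys"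
  unfolding hclass_def using homotopic_refl homotopic_sym homotopic_trans by blast

lemma homotopic_induct [consumes 1, case_names refl add remove]:
  assumes "homotopic E xs ys" and "P xs"
    and "\<And>ys zs. homotopic E xs ys \<Longrightarrow> P ys \<Longrightarrow> add_point E ys zs \<Longrightarrow> P zs"
    and "\<And>ys zs. homotopic E xs ys \<Longrightarrow> P ys \<Longrightarrow> add_point E zs ys \<Longrightarrow> P zs"
  shows "P ys"
  using assms(1)[unfolded homotopic_def]
proof (induction rule: equivclp_induct)
  case base
  show ?case by (rule assms(2))
next
  case (step ys zs)
  then show ?case using assms(3,4) unfolding homotopic_def by blast
qed

lemma homotopic_endpoints:
  assumes "homotopic E xs ys"
  shows "hd ys = hd xs" "last ys = last xs" "echain E ys \<longleftrightarrow> echain E xs"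
  using assms by (induction rule: homotopic_induct) (auto simp: add_point_def)

lemma homotopic_mono:
  assumes "homotopic D xs ys" "D \<subseteq> E"
  shows "homotopic E xs ys"
proof -
  have chain: "echain E ys" if "echain D ys" for ys
    using that assms(2) unfolding echain_def
    by (metis (mono_tags, lifting) subsetD successively_mono)
  have mono: "homotopic E ys zs" if "add_point D ys zs" for ys zs
    using that chain by (intro add_point_homotopic) (simp add: add_point_def)
  show ?thesis using assms(1)
  proof (induction rule: homotopic_induct)
    case (add ys zs)
    then show ?case using homotopic_trans mono by blast
  next
    case (remove ys zs)
    then show ?case using homotopic_trans homotopic_sym mono by blast
  qed simp
qed


section \<open>The spaces of classes of chains\<close>

definition chain_space :: "'a \<Rightarrow> ('a \<times> 'a) set \<Rightarrow> 'a list set set" where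
  "chain_space b E = hclass E ` {xs. echain E xs \<and> hd xs = b}"

definition star_entourage ::
    "'a \<Rightarrow> ('a \<times> 'a) set \<Rightarrow> ('a \<times> 'a) set \<Rightarrow> ('a list set \<times> 'a list set) set" where
  "star_entourage b E D =
     {(hclass E (xs @ [y]), hclass E (xs @ [z])) | xs y z.
        xs \<noteq> [] \<and> hd xs = b \<and> echain E (xs @ [y]) \<and> echain E (xs @ [z]) \<and> (y, z) \<in> D}"

definition chain_uniformity ::
    "'a::uniform_space \<Rightarrow> ('a \<times> 'a) set \<Rightarrow> ('a list set \<times> 'a list set) filter" where
  "chain_uniformity b E = (INF D\<in>{D \<in> entourages. D \<subseteq> E}. principal (star_entourage b E D))"

lemma eventually_chain_uniformity:
  assumes "E \<in> entourages"
  shows "eventually P (chain_uniformity b E) \<longleftrightarrow>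
           (\<exists>D\<in>entourages. D \<subseteq> E \<and> (\<forall>p\<in>star_entourage b E D. P p))"
proof -
  have inter: "D \<inter> D' \<in> entourages" if "D \<in> entourages" "D' \<in> entourages"
    for D D' :: "('a \<times> 'a) set"
    using that by (auto simp: entourages_on_def sym_Int intro: eventually_conj)
  have "eventually P (chain_uniformity b E) \<longleftrightarrow>
          (\<exists>D\<in>{D \<in> entourages. D \<subseteq> E}. eventually P (principal (star_entourage b E D)))"
    unfolding chain_uniformity_def
  proof (rule eventually_INF_base)
    fix D D' assume D: "D \<in> {D \<in> entourages. D \<subseteq> E}" "D' \<in> {D \<in> entourages. D \<subseteq> E}"
    have "star_entourage b E (D \<inter> D') \<subseteq> star_entourage b E D \<inter> star_entourage b E D'"
      by (auto simp: star_entourage_def)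
    then show "\<exists>C\<in>{D \<in> entourages. D \<subseteq> E}. principal (star_entourage b E C)
                 \<le> inf (principal (star_entourage b E D)) (principal (star_entourage b E D'))"
      using D inter[of D D'] by (intro bexI[of _ "D \<inter> D'"]) auto
  qed (use assms in auto)
  then show ?thesis by (auto simp: eventually_principal)
qed

lemma chain_uniformity_le:
  assumes "E \<in> entourages"
  shows "chain_uniformity b E \<le> principal (chain_space b E \<times> chain_space b E)"
proof -
  have "star_entourage b E E \<subseteq> chain_space b E \<times> chain_space b E"
    by (auto simp: star_entourage_def chain_space_def intro!: imageI)
  then show ?thesis
    unfolding le_principal eventually_chain_uniformity[OF assms] using assms by blast
qed

text \<open>
  Induced maps on classes: \<^term>\<open>the_elem\<close> picks the common value at all representatives.
\<close>

definition endpoint :: "'a list set \<Rightarrow> 'a" where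
  "endpoint c = the_elem (last ` c)"

definition bonding :: "('a \<times> 'a) set \<Rightarrow> 'a list set \<Rightarrow> 'a list set" where
  "bonding E c = the_elem (hclass E ` c)"

lemma endpoint_hclass [simp]: "endpoint (hclass E xs) = last xs"
proof -
  have "last ` hclass E xs = {last xs}"
    using homotopic_endpoints(2) homotopic_refl unfolding hclass_def by fastforce
  then show ?thesis by (simp add: endpoint_def)
qed

lemma bonding_hclass:
  assumes "D \<subseteq> E"
  shows "bonding E (hclass D xs) = hclass E xs"
proof -
  have "hclass E ys = hclass E xs" if "ys \<in> hclass D xs" for ys
    using that assms homotopic_mono homotopic_sym by (metis hclass_def hclass_eq_iff mem_Collect_eq)
  moreover have "xs \<in> hclass D xs" by (simp add: hclass_def)
  ultimately have "hclass E ` hclass D xs = {hclass E xs}" by blast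
  then show ?thesis by (simp add: bonding_def)
qed

definition entourage_limit ::
    "(('a::uniform_space \<times> 'a) set \<Rightarrow> 'a list set set) \<Rightarrow> (('a \<times> 'a) set \<Rightarrow> 'a list set) set" where
  "entourage_limit S = {x \<in> (\<Pi>\<^sub>E E\<in>entourages. S E).
     \<forall>D\<in>entourages. \<forall>E\<in>entourages. D \<subseteq> E \<longrightarrow> bonding E (x D) = x E}"

text \<open>
  Only the points of the inverse limit are needed: coverability asks for surjectivity of the
  projections and does not refer to the inverse limit uniformity.
\<close>

definition universal_cover :: "'a::uniform_space \<Rightarrow> (('a \<times> 'a) set \<Rightarrow> 'a list set) set" where
  "universal_cover b = entourage_limit (chain_space b)"

definition coverable :: "'a::uniform_space \<Rightarrow> bool" where
  "coverable b \<longleftrightarrow> (\<exists>B. entourage_base B \<and> UNIV \<in> B \<and>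
     (\<forall>E\<in>B. (\<lambda>x. x E) ` universal_cover b = chain_space b E))"

definition universal :: "'a::uniform_space \<Rightarrow> bool" where
  "universal b \<longleftrightarrow> (\<exists>B. entourage_base B \<and>
     (\<forall>E\<in>B. uniform_homeomorphism (chain_space b E) (chain_uniformity b E) UNIV uniformity endpoint))"


section \<open>Deck groups\<close>

text \<open>Concatenation of loops drops the repeated base point.\<close>

definition deck_group :: "'a \<Rightarrow> ('a \<times> 'a) set \<Rightarrow> 'a list set monoid" where
  "deck_group b E =
     \<lparr>carrier = hclass E ` {xs. echain E xs \<and> hd xs = b \<and> last xs = b},
      monoid.mult = (\<lambda>c d. the_elem {hclass E (xs @ tl ys) | xs ys. xs \<in> c \<and> ys \<in> d}),
      one = hclass E [b]\<rparr>"

definition limit_deck_group ::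
    "'a::uniform_space \<Rightarrow> (('a \<times> 'a) set \<Rightarrow> 'a list set) monoid" where
  "limit_deck_group b =
     (product_group entourages (deck_group b))
       \<lparr>carrier := entourage_limit (\<lambda>E. carrier (deck_group b E))\<rparr>"

lemma echain_append:
  assumes "echain E xs" "echain E ys" "last xs = hd ys"
  shows "echain E (xs @ tl ys)" "hd (xs @ tl ys) = hd xs" "last (xs @ tl ys) = last ys"
  using assms by (cases ys; auto simp: echain_def successively_append_iff successively_Cons)+

lemma homotopic_append:
  assumes xs: "homotopic E xs xs'" and ys: "homotopic E ys ys'"
    and chains: "echain E xs" "echain E ys" "last xs = hd ys"
  shows "homotopic E (xs @ tl ys) (xs' @ tl ys')"
proof -
  have left: "homotopic E (us @ tl ys) (vs @ tl ys)"
    if "add_point E us vs" "last us = hd ys" for us vs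
  proof (rule add_point_homotopic)
    from that obtain u w v where uv: "us = u @ v" "vs = u @ w # v"
      and c: "echain E us" "echain E vs" "hd vs = hd us" "last vs = last us"
      by (auto simp: add_point_def)
    have "\<exists>u w v. us @ tl ys = u @ v \<and> vs @ tl ys = u @ w # v"
      using uv by (metis append.assoc append_Cons)
    then show "add_point E (us @ tl ys) (vs @ tl ys)"
      using echain_append[OF c(1) chains(2)] echain_append[OF c(2) chains(2)] c that
      unfolding add_point_def by auto
  qed
  have right: "homotopic E (xs' @ tl us) (xs' @ tl vs)"
    if "add_point E us vs" "last xs' = hd us" "echain E xs'" for us vs
  proof (rule add_point_homotopic)
    from that(1) obtain u w v where uv: "us = u @ v" "vs = u @ w # v"
      and c: "echain E us" "echain E vs" "hd vs = hd us" "last vs = last us"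
      by (auto simp: add_point_def)
    have "\<exists>u w v. xs' @ tl us = u @ v \<and> xs' @ tl vs = u @ w # v"
    proof (cases u)
      case Nil
      then have "tl vs = hd v # tl v" using uv c by (auto simp: echain_def)
      then show ?thesis using uv Nil by auto
    next
      case (Cons a u')
      then have "xs' @ tl us = (xs' @ u') @ v" "xs' @ tl vs = (xs' @ u') @ w # v"
        using uv by auto
      then show ?thesis by blast
    qed
    then show "add_point E (xs' @ tl us) (xs' @ tl vs)"
      using echain_append[OF that(3) c(1)] echain_append[OF that(3) c(2)] c that
      unfolding add_point_def by auto
  qed
  have "homotopic E (xs @ tl ys) (xs' @ tl ys)"
    using xs
  proof (induction rule: homotopic_induct)
    case (add us vs)
    then show ?case
      using left[of us vs] homotopic_endpoints(2)[OF add(1)] chains homotopic_trans by metis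
  next
    case (remove us vs)
    then have "last vs = hd ys"
      using homotopic_endpoints(2)[OF remove(1)] chains by (simp add: add_point_def)
    then show ?case
      using left[of vs us] remove homotopic_trans homotopic_sym by metis
  qed simp
  also have "homotopic E (xs' @ tl ys) (xs' @ tl ys')"
    using ys
  proof (induction rule: homotopic_induct)
    case (add us vs)
    then show ?case
      using right[of us vs] homotopic_endpoints[OF add(1)] homotopic_endpoints[OF xs] chains
        homotopic_trans by metis
  next
    case (remove us vs)
    then have "last xs' = hd vs"
      using homotopic_endpoints[OF remove(1)] homotopic_endpoints[OF xs] chains
      by (simp add: add_point_def)
    then show ?case
      using right[of vs us] remove homotopic_endpoints[OF xs] chains homotopic_trans homotopic_sym
      by metis
  qed simp
  finally show ?thesis .
qed

lemma deck_group_mult: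
  assumes "echain E xs" "echain E ys" "last xs = b" "hd ys = b"
  shows "hclass E xs \<otimes>\<^bsub>deck_group b E\<^esub> hclass E ys = hclass E (xs @ tl ys)"
proof -
  have "hclass E (xs' @ tl ys') = hclass E (xs @ tl ys)"
    if "xs' \<in> hclass E xs" "ys' \<in> hclass E ys" for xs' ys'
    using that homotopic_append[of E xs xs' ys ys'] assms
    unfolding hclass_eq_iff by (metis hclass_def homotopic_sym mem_Collect_eq)
  moreover have "xs \<in> hclass E xs" "ys \<in> hclass E ys" by (auto simp: hclass_def)
  ultimately have "{hclass E (xs' @ tl ys') | xs' ys'. xs' \<in> hclass E xs \<and> ys' \<in> hclass E ys}
      = {hclass E (xs @ tl ys)}" by blast
  then show ?thesis by (simp add: deck_group_def)
qed

lemma successively_rev_sym: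
  assumes "sym E"
  shows "successively (\<lambda>x y. (x, y) \<in> E) (rev xs) \<longleftrightarrow> successively (\<lambda>x y. (x, y) \<in> E) xs"
proof -
  have "(\<lambda>x y. (y, x) \<in> E) = (\<lambda>x y. (x, y) \<in> E)"
    using assms by (auto simp: fun_eq_iff sym_def)
  then show ?thesis unfolding successively_rev by (rule arg_cong[where f = "\<lambda>P. successively P xs"])
qed

lemma add_pointI:
  assumes "echain E (us @ vs)" "echain E (us @ w # vs)"
    and "hd (us @ w # vs) = hd (us @ vs)" "last (us @ w # vs) = last (us @ vs)"
  shows "add_point E (us @ vs) (us @ w # vs)"
  using assms unfolding add_point_def by blast

lemma homotopic_rev_append:
  assumes "sym E" "refl E" "echain E xs"
  shows "homotopic E (rev xs @ tl xs) [last xs]"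
  using assms(3)
proof (induction xs)
  case (Cons x xs)
  show ?case
  proof (cases "xs = []")
    case False
    then obtain y ys where xs: "xs = y # ys" by (cases xs) auto
    have xy: "(x, y) \<in> E" "echain E xs"
      using Cons.prems xs by (auto simp: echain_def)
    have yx: "(y, x) \<in> E" "(y, y) \<in> E"
      using symD[OF assms(1) xy(1)] reflD[OF assms(2)] by blast+
    have "successively (\<lambda>x y. (x, y) \<in> E) (y # ys)"
      using xy(2) xs by (simp add: echain_def)
    moreover from this have "successively (\<lambda>x y. (x, y) \<in> E) (rev ys @ [y])"
      using successively_rev_sym[OF assms(1), of "y # ys"] by simp
    ultimately have ch: "echain E (rev ys @ [y, y] @ ys)" "echain E (rev ys @ [y, x, y] @ ys)"
        "echain E (rev ys @ [y] @ ys)"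
      using xy(1) yx
      by (simp_all add: echain_def successively_append_iff successively_Cons del: successively_rev)
    have ap: "add_point E (rev ys @ [y, y] @ ys) (rev ys @ [y, x, y] @ ys)"
      using add_pointI[of E "rev ys @ [y]" "[y] @ ys" x] ch by (simp add: hd_append)
    have ap': "add_point E (rev ys @ [y] @ ys) (rev ys @ [y, y] @ ys)"
      using add_pointI[of E "rev ys @ [y]" ys y] ch by (simp add: hd_append)
    have "homotopic E (rev ys @ [y, x, y] @ ys) (rev ys @ [y] @ ys)"
      using ap ap' add_point_homotopic homotopic_trans homotopic_sym by metis
    also have "homotopic E (rev ys @ [y] @ ys) [last xs]"
      using Cons.IH xy(2) xs by simp
    finally show ?thesis using xs by simp
  qed simp
qed (simp add: echain_def)

lemma entourage_refl: "E \<in> entourages \<Longrightarrow> refl E"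
  using uniformity_refl by (fastforce simp: entourages_on_def refl_on_def)

lemma group_deck_group:
  assumes "E \<in> entourages"
  shows "group (deck_group b E)"
proof (rule groupI)
  have sym: "sym E" using assms by (simp add: entourages_on_def)
  have carrierE: "\<exists>xs. echain E xs \<and> hd xs = b \<and> last xs = b \<and> c = hclass E xs"
    if "c \<in> carrier (deck_group b E)" for c
    using that by (auto simp: deck_group_def)
  have carrierI: "hclass E xs \<in> carrier (deck_group b E)"
    if "echain E xs" "hd xs = b" "last xs = b" for xs
    using that by (auto simp: deck_group_def)
  have one: "\<one>\<^bsub>deck_group b E\<^esub> = hclass E [b]" by (simp add: deck_group_def)
  have b: "echain E [b]" by (simp add: echain_def)
  show "\<one>\<^bsub>deck_group b E\<^esub> \<in> carrier (deck_group b E)"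
    unfolding one by (rule carrierI) (simp_all add: echain_def)
  fix c assume "c \<in> carrier (deck_group b E)"
  then obtain xs where xs: "echain E xs" "hd xs = b" "last xs = b" "c = hclass E xs"
    using carrierE by blast
  have "hclass E [b] \<otimes>\<^bsub>deck_group b E\<^esub> hclass E xs = hclass E ([b] @ tl xs)"
    by (rule deck_group_mult) (use xs b in auto)
  moreover have "[b] @ tl xs = xs" using xs by (cases xs) (auto simp: echain_def)
  ultimately show "\<one>\<^bsub>deck_group b E\<^esub> \<otimes>\<^bsub>deck_group b E\<^esub> c = c"
    unfolding one xs(4) by simp
  have rev: "echain E (rev xs)" "hd (rev xs) = b" "last (rev xs) = b"
    using xs by (auto simp: echain_def hd_rev last_rev successively_rev_sym[OF sym]
        simp del: successively_rev)
  have "hclass E (rev xs) \<otimes>\<^bsub>deck_group b E\<^esub> c = \<one>\<^bsub>deck_group b E\<^esub>"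
    unfolding one xs(4)
    using deck_group_mult[of E "rev xs" xs b] rev xs
      homotopic_rev_append[OF sym entourage_refl[OF assms] xs(1)]
    by (simp add: hclass_eq_iff)
  then show "\<exists>d\<in>carrier (deck_group b E). d \<otimes>\<^bsub>deck_group b E\<^esub> c = \<one>\<^bsub>deck_group b E\<^esub>"
    using carrierI[OF rev] by blast
  fix d assume "d \<in> carrier (deck_group b E)"
  then obtain ys where ys: "echain E ys" "hd ys = b" "last ys = b" "d = hclass E ys"
    using carrierE by blast
  have cd: "c \<otimes>\<^bsub>deck_group b E\<^esub> d = hclass E (xs @ tl ys)"
    unfolding xs(4) ys(4) by (rule deck_group_mult) (use xs ys in auto)
  have xy: "echain E (xs @ tl ys)" "hd (xs @ tl ys) = b" "last (xs @ tl ys) = b"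
    using echain_append[OF xs(1) ys(1)] xs ys by auto
  show "c \<otimes>\<^bsub>deck_group b E\<^esub> d \<in> carrier (deck_group b E)"
    unfolding cd by (rule carrierI[OF xy])
  fix e assume "e \<in> carrier (deck_group b E)"
  then obtain zs where zs: "echain E zs" "hd zs = b" "last zs = b" "e = hclass E zs"
    using carrierE by blast
  have yz: "echain E (ys @ tl zs)" "hd (ys @ tl zs) = b"
    using echain_append[OF ys(1) zs(1)] ys zs by auto
  have "ys \<noteq> []" using ys(1) by (simp add: echain_def)
  then show "c \<otimes>\<^bsub>deck_group b E\<^esub> d \<otimes>\<^bsub>deck_group b E\<^esub> e
      = c \<otimes>\<^bsub>deck_group b E\<^esub> (d \<otimes>\<^bsub>deck_group b E\<^esub> e)"
    unfolding cd unfolding xs(4) ys(4) zs(4)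
    using deck_group_mult[OF xy(1) zs(1) xy(3) zs(2)] deck_group_mult[OF ys(1) zs(1) ys(3) zs(2)]
      deck_group_mult[OF xs(1) yz(1) xs(3) yz(2)] by simp
qed

end

theory Submission
  imports Defs
begin

text \<open>
  The proof works with representatives. If the end point map \<open>X\<^sub>E \<rightarrow> X\<close> is bijective, it is
  automatically a uniform homeomorphism, because a \<open>D\<close>-step in \<open>X\<close> lifts to a \<open>D\<^sup>*\<close>-step in
  \<open>X\<^sub>E\<close> (\<open>uniform_homeomorphism_endpoint_iff\<close>), and it is injective exactly when
  \<open>\<delta>\<^sub>E(X)\<close> is trivial (\<open>inj_endpoint_iff\<close>). Hence \<open>X\<close> is universal iff it has a base of
  entourages \<open>E\<close> such that \<open>X\<close> is \<open>E\<close>-chain connected and \<open>\<delta>\<^sub>E(X)\<close> is trivial. In a coverable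
  space any two points are joined by \<open>E\<close>-chains for every \<open>E\<close>, so only the deck groups matter.

  The space \<open>X\<^sub>E\<close> is chain connected iff, for each smaller \<open>D\<close>, every \<open>E\<close>-chain from the base
  point is \<open>E\<close>-homotopic to a \<open>D\<close>-chain (\<open>chain_connected_chain_space_iff\<close>). This has two
  consequences. If \<open>X\<^sub>E\<close> is chain connected, then \<open>\<delta>\<^sub>D(X) \<rightarrow> \<delta>\<^sub>E(X)\<close> is onto for each \<open>D \<subseteq> E\<close>,
  so triviality passes from the small entourages of a universal base to \<open>E\<close>: universality implies
  the condition on deck groups. If \<open>\<phi>\<^sub>E\<close> is onto, then so are the maps \<open>X\<^sub>D \<rightarrow> X\<^sub>E\<close>, and \<open>X\<^sub>E\<close> is
  chain connected. Thus the condition on deck groups makes \<open>\<delta>\<^sub>E(X)\<close> trivial for all \<open>E\<close> in the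
  base provided by coverability. This gives universality, and also triviality of \<open>\<delta>\<^sub>1(X)\<close>,
  because a point of an inverse limit is determined by its coordinates in a base.

  Finally, the points of \<open>\<delta>\<^sub>1(X)\<close> are the points of the inverse limit that lie over the base
  point. If \<open>\<phi>\<^sub>E\<close> is onto, every class in \<open>\<delta>\<^sub>E(X)\<close> therefore comes from \<open>\<delta>\<^sub>1(X)\<close>. So triviality of
  \<open>\<delta>\<^sub>1(X)\<close> makes \<open>\<delta>\<^sub>E(X)\<close> trivial on the base provided by coverability, which is universality again.
\<close>

section \<open>Chains and their classes\<close>

lemma entouragesD:
  assumes "E \<in> entourages"
  shows "sym E" "(x, x) \<in> E"
  using assms entourage_refl[OF assms] by (auto simp: entourages_on_def refl_on_def)

lemma UNIV_entourage: "UNIV \<in> entourages"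
  by (simp add: entourages_on_def sym_def)

lemma echain_singleton [simp]: "echain E [x]"
  by (simp add: echain_def)

lemma echain_mono: "echain D xs \<Longrightarrow> D \<subseteq> E \<Longrightarrow> echain E xs"
  unfolding echain_def by (metis (mono_tags, lifting) subsetD successively_mono)

lemma echain_snoc: "xs \<noteq> [] \<Longrightarrow> echain E (xs @ [y]) \<longleftrightarrow> echain E xs \<and> (last xs, y) \<in> E"
  by (auto simp: echain_def successively_append_iff)

lemma echain_rev:
  assumes "sym E" "echain E xs"
  shows "echain E (rev xs)"
  using assms(2) successively_rev_sym[OF assms(1), of xs]
  by (simp add: echain_def del: successively_rev)

lemma chain_spaceE:
  assumes "c \<in> chain_space b E"
  obtains xs where "echain E xs" "hd xs = b" "c = hclass E xs"
  using assms by (auto simp: chain_space_def)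

lemma hclass_in_chain_space: "echain E xs \<Longrightarrow> hd xs = b \<Longrightarrow> hclass E xs \<in> chain_space b E"
  by (auto simp: chain_space_def)

lemma deck_group_carrier:
  "carrier (deck_group b E) = {c \<in> chain_space b E. endpoint c = b}"
  by (auto simp: deck_group_def chain_space_def)

lemma homotopic_repeat_last:
  assumes "echain E xs" "(last xs, last xs) \<in> E"
  shows "homotopic E (xs @ [last xs]) xs"
proof -
  have "xs \<noteq> []" using assms(1) by (simp add: echain_def)
  then have "add_point E (xs @ []) (xs @ [last xs])"
    by (intro add_pointI) (use assms in \<open>auto simp: echain_snoc\<close>)
  then show ?thesis using add_point_homotopic homotopic_sym by fastforce
qed

section \<open>Bijectivity of the endpoint map\<close>

lemma trivial_deck_group_iff:
  assumes "E \<in> entourages"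
  shows "trivial_group (deck_group b E) \<longleftrightarrow>
    (\<forall>xs. echain E xs \<and> hd xs = b \<and> last xs = b \<longrightarrow> homotopic E xs [b])"
proof -
  have one: "hclass E [b] \<in> carrier (deck_group b E)"
    by (auto simp: deck_group_def intro!: imageI)
  have "trivial_group (deck_group b E) \<longleftrightarrow> carrier (deck_group b E) \<subseteq> {hclass E [b]}"
    using group_deck_group[OF assms] one
    by (auto simp: trivial_group_def deck_group_def)
  then show ?thesis
    by (auto simp: deck_group_def image_subset_iff hclass_eq_iff)
qed

text \<open>
  Two chains with a common end point differ by the loop that follows the first one and returns
  along the second one.
\<close>

lemma inj_endpoint_iff:
  assumes E: "E \<in> entourages"
  shows "inj_on endpoint (chain_space b E) \<longleftrightarrow> trivial_group (deck_group b E)"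
  unfolding trivial_deck_group_iff[OF E]
proof (intro iffI allI impI inj_onI)
  fix xs assume inj: "inj_on endpoint (chain_space b E)"
    and "echain E xs \<and> hd xs = b \<and> last xs = b"
  then have "hclass E xs = hclass E [b]"
    by (intro inj_onD[OF inj]) (auto intro!: hclass_in_chain_space)
  then show "homotopic E xs [b]" by (simp add: hclass_eq_iff)
next
  fix c d
  assume triv: "\<forall>xs. echain E xs \<and> hd xs = b \<and> last xs = b \<longrightarrow> homotopic E xs [b]"
    and "c \<in> chain_space b E" "d \<in> chain_space b E" and eq: "endpoint c = endpoint d"
  then obtain xs ys where xs: "echain E xs" "hd xs = b" "c = hclass E xs"
    and ys: "echain E ys" "hd ys = b" "d = hclass E ys"
    by (metis chain_spaceE)
  have ends: "last xs = last ys" using eq xs ys by simp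
  have ne: "xs \<noteq> []" "ys \<noteq> []" using xs ys by (auto simp: echain_def)
  have rev: "echain E (rev ys)" "hd (rev ys) = last xs" "last (rev ys) = b"
    using echain_rev[OF entouragesD(1)[OF E] ys(1)] ends ys ne
    by (auto simp: hd_rev last_rev)
  note loop = echain_append[OF xs(1) rev(1) rev(2)[symmetric]]
  have retrace: "homotopic E (rev ys @ tl ys) [last ys]"
    by (rule homotopic_rev_append[OF entouragesD(1)[OF E] entourage_refl[OF E] ys(1)])
  have retrace_chain: "echain E (rev ys @ tl ys)" "hd (rev ys @ tl ys) = last xs"
    using echain_append[OF rev(1) ys(1)] rev ys by auto
  have "homotopic E ((xs @ tl (rev ys)) @ tl ys) ([b] @ tl ys)"
    by (rule homotopic_append) (use triv loop rev xs ys in auto)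
  moreover have "[b] @ tl ys = ys" using ne(2) ys(2) by (cases ys) auto
  ultimately have "homotopic E (xs @ tl (rev ys @ tl ys)) ys"
    using ne by simp
  moreover have "homotopic E (xs @ tl (rev ys @ tl ys)) (xs @ tl [last ys])"
    by (rule homotopic_append) (use retrace retrace_chain xs in auto)
  ultimately have "homotopic E xs ys"
    using homotopic_sym homotopic_trans by fastforce
  then show "c = d" using xs ys by (simp add: hclass_eq_iff)
qed

lemma endpoint_star_entourage:
  "(c, d) \<in> star_entourage b E D \<Longrightarrow> (endpoint c, endpoint d) \<in> D"
  by (auto simp: star_entourage_def)

text \<open>
  A pair in \<open>D\<^sup>*\<close> consists of two one-point extensions of a common chain; repeating the last
  point exhibits a class as such an extension of its own representative.
\<close>

lemma star_entourage_extend: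
  assumes "E \<in> entourages" "D \<subseteq> E" "echain E xs" "(last xs, z) \<in> D"
  shows "(hclass E xs, hclass E (xs @ [z])) \<in> star_entourage (hd xs) E D"
proof -
  have "xs \<noteq> []" using assms(3) by (simp add: echain_def)
  moreover have "hclass E xs = hclass E (xs @ [last xs])"
    using homotopic_repeat_last[OF assms(3) entouragesD(2)[OF assms(1)]]
    by (metis hclass_eq_iff)
  moreover have "(last xs, last xs) \<in> E" by (rule entouragesD(2)[OF assms(1)])
  ultimately show ?thesis
    unfolding star_entourage_def using assms by (force simp: echain_snoc)
qed

lemma uniform_homeomorphism_endpoint_iff:
  fixes b :: "'a::uniform_space"
  assumes E: "E \<in> entourages"
  shows "uniform_homeomorphism (chain_space b E) (chain_uniformity b E) UNIV uniformity endpoint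
    \<longleftrightarrow> bij_betw endpoint (chain_space b E) UNIV"
proof
  assume bij: "bij_betw endpoint (chain_space b E) UNIV"
  let ?g = "inv_into (chain_space b E) endpoint"
  have g: "?g y \<in> chain_space b E" "endpoint (?g y) = y" for y
    using bij_betwE[OF bij_betw_inv_into[OF bij]] bij_betw_inv_into_right[OF bij] by auto
  have gI: "?g (endpoint c) = c" if "c \<in> chain_space b E" for c
    using bij that by (rule bij_betw_inv_into_left)
  have small: "\<exists>D\<in>entourages. D \<subseteq> E \<and> (\<forall>p\<in>D. P p)" if "eventually P uniformity"
    for P :: "'a \<times> 'a \<Rightarrow> bool"
  proof -
    \<comment> \<open>Entourages are symmetric here, so a uniform event is cut down to its symmetric part.\<close>
    let ?D = "{(x, y). P (x, y) \<and> P (y, x)} \<inter> E"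
    have "eventually (\<lambda>(x, y). P (y, x)) uniformity"
      using uniformity_sym[OF that] by simp
    then have "eventually (\<lambda>p. p \<in> ?D) uniformity"
      using that E by (auto simp: entourages_on_def elim: eventually_elim2 intro!: eventually_conj)
    moreover have "sym ?D" using entouragesD(1)[OF E] by (auto simp: sym_def)
    ultimately have "?D \<in> entourages" by (simp add: entourages_on_def)
    then show ?thesis by (intro bexI[of _ ?D]) auto
  qed
  have "uniformly_continuous_map (chain_space b E) (chain_uniformity b E) UNIV uniformity endpoint"
    unfolding uniformly_continuous_map_def filterlim_iff eventually_chain_uniformity[OF E]
  proof (intro conjI allI impI)
    fix P :: "'a \<times> 'a \<Rightarrow> bool" assume "eventually P uniformity"
    then obtain D where "D \<in> entourages" "D \<subseteq> E" "\<forall>p\<in>D. P p" using small by blast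
    then show "\<exists>D\<in>entourages. D \<subseteq> E \<and>
        (\<forall>p\<in>star_entourage b E D. P (case p of (c, d) \<Rightarrow> (endpoint c, endpoint d)))"
      by (intro bexI[of _ D]) (auto dest: endpoint_star_entourage)
  qed simp
  moreover have
    "uniformly_continuous_map UNIV uniformity (chain_space b E) (chain_uniformity b E) ?g"
    unfolding uniformly_continuous_map_def filterlim_iff eventually_chain_uniformity[OF E]
  proof (intro conjI allI impI)
    show "?g ` UNIV \<subseteq> chain_space b E" using g(1) by auto
    fix P assume "\<exists>D\<in>entourages. D \<subseteq> E \<and> (\<forall>p\<in>star_entourage b E D. P p)"
    then obtain D where D: "D \<in> entourages" "D \<subseteq> E" "\<forall>p\<in>star_entourage b E D. P p" by blast
    have "(?g y, ?g z) \<in> star_entourage b E D" if yz: "(y, z) \<in> D" for y z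
    proof -
      obtain xs where xs: "echain E xs" "hd xs = b" "?g y = hclass E xs"
        using g(1) by (rule chain_spaceE)
      then have "last xs = y" using g(2)[of y] by simp
      then have star: "(?g y, hclass E (xs @ [z])) \<in> star_entourage b E D"
        using star_entourage_extend[OF E D(2) xs(1), of z] xs yz by simp
      have "xs \<noteq> []" using xs(1) by (simp add: echain_def)
      then have "hclass E (xs @ [z]) \<in> chain_space b E"
        using xs D(2) yz \<open>last xs = y\<close> by (intro hclass_in_chain_space) (auto simp: echain_snoc)
      from gI[OF this] star show ?thesis by simp
    qed
    moreover have "eventually (\<lambda>p. p \<in> D) uniformity" using D by (simp add: entourages_on_def)
    ultimately show "eventually (\<lambda>p. P (case p of (y, z) \<Rightarrow> (?g y, ?g z))) uniformity"
      using D(3) by (auto elim!: eventually_mono)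
  qed
  ultimately show
    "uniform_homeomorphism (chain_space b E) (chain_uniformity b E) UNIV uniformity endpoint"
    using bij by (simp add: uniform_homeomorphism_def)
qed (simp add: uniform_homeomorphism_def)

lemma universal_iff:
  fixes b :: "'a::uniform_space"
  shows "universal b \<longleftrightarrow> (\<exists>B. entourage_base B \<and>
    (\<forall>E\<in>B. endpoint ` chain_space b E = UNIV \<and> trivial_group (deck_group b E)))"
proof -
  have "uniform_homeomorphism (chain_space b E) (chain_uniformity b E) UNIV uniformity endpoint
      \<longleftrightarrow> endpoint ` chain_space b E = UNIV \<and> trivial_group (deck_group b E)"
    if "entourage_base B" "E \<in> B" for B and E :: "('a \<times> 'a) set"
  proof -
    have "E \<in> entourages" using that by (auto simp: entourage_base_def)
    then show ?thesis
      by (auto simp: uniform_homeomorphism_endpoint_iff inj_endpoint_iff[symmetric] bij_betw_def)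
  qed
  then show ?thesis unfolding universal_def by blast
qed

section \<open>Chain connected spaces of classes\<close>

lemma star_entourage_on:
  assumes E: "E \<in> entourages" and D: "D \<in> entourages" "D \<subseteq> E"
  shows "star_entourage b E D \<in> entourages_on (chain_space b E) (chain_uniformity b E)"
proof -
  have "star_entourage b E D \<subseteq> chain_space b E \<times> chain_space b E"
    by (auto simp: star_entourage_def intro!: hclass_in_chain_space)
  moreover have "sym (star_entourage b E D)"
    using entouragesD(1)[OF D(1)] unfolding star_entourage_def sym_def by blast
  ultimately show ?thesis
    unfolding entourages_on_def using eventually_chain_uniformity[OF E] D by blast
qed

text \<open>
  A \<open>D\<^sup>*\<close>-step changes only the last point of a chain, and its new last point can equally well be
  appended; so a \<open>D\<^sup>*\<close>-chain starting at the trivial class spells out a \<open>D\<close>-chain in \<open>X\<close>.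
\<close>

lemma star_chain_last:
  assumes "D \<subseteq> E" "cs \<noteq> []" "successively (\<lambda>c d. (c, d) \<in> star_entourage b E D) cs"
    and "hd cs = hclass E [b]"
  shows "\<exists>xs. echain D xs \<and> hd xs = b \<and> last cs = hclass E xs"
  using assms(2-4)
proof (induction cs rule: rev_nonempty_induct)
  case (single c)
  then show ?case by (intro exI[of _ "[b]"]) simp
next
  case (snoc c cs)
  then obtain xs where xs: "echain D xs" "hd xs = b" "last cs = hclass E xs"
    by (auto simp: successively_append_iff)
  have "(last cs, c) \<in> star_entourage b E D"
    using snoc by (auto simp: successively_append_iff)
  then obtain us y z where us: "us \<noteq> []" "hclass E xs = hclass E (us @ [y])"
      "c = hclass E (us @ [z])" "echain E (us @ [y])" "echain E (us @ [z])" "(y, z) \<in> D"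
    unfolding xs(3) star_entourage_def by blast
  have ne: "xs \<noteq> []" using xs(1) by (simp add: echain_def)
  have hom: "homotopic E (us @ [y]) xs" using us(2) by (metis hclass_eq_iff)
  then have last: "last xs = y" using homotopic_endpoints(2) by fastforce
  have yz: "(y, z) \<in> E" using us(6) assms(1) by blast
  have "add_point E (us @ [z]) (us @ [y] @ [z])"
    using add_pointI[of E us "[z]" y] us yz by (simp add: echain_def successively_append_iff)
  then have "homotopic E (us @ [z]) ((us @ [y]) @ tl [y, z])"
    by (simp add: add_point_homotopic)
  also have "homotopic E \<dots> (xs @ tl [y, z])"
    by (rule homotopic_append) (use hom us yz in \<open>auto simp: echain_def\<close>)
  finally have "c = hclass E (xs @ [z])" using us(3) by (simp add: hclass_eq_iff)
  moreover have "echain D (xs @ [z])" using xs ne us last by (simp add: echain_snoc)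
  ultimately show ?case using xs(2) ne by (intro exI[of _ "xs @ [z]"]) simp
qed

text \<open>The classes of the initial segments of a \<open>D\<close>-chain form a \<open>D\<^sup>*\<close>-chain.\<close>

lemma star_chain_of_echain:
  assumes "E \<in> entourages" "D \<subseteq> E" "echain D xs" "hd xs = b"
  shows "\<exists>cs. echain (star_entourage b E D) cs \<and> hd cs = hclass E [b] \<and> last cs = hclass E xs"
proof -
  have "xs \<noteq> []" using assms(3) by (simp add: echain_def)
  then show ?thesis using assms(3,4)
  proof (induction xs rule: rev_nonempty_induct)
    case (single x)
    then show ?case by (intro exI[of _ "[hclass E [b]]"]) simp
  next
    case (snoc x xs)
    then have xs: "echain D xs" "(last xs, x) \<in> D" "hd xs = b"
      by (auto simp: echain_snoc)
    then obtain cs where cs: "echain (star_entourage b E D) cs" "hd cs = hclass E [b]"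
        "last cs = hclass E xs"
      using snoc.IH by blast
    have "(hclass E xs, hclass E (xs @ [x])) \<in> star_entourage b E D"
      using star_entourage_extend[OF assms(1,2) echain_mono[OF xs(1) assms(2)] xs(2)] xs(3) by simp
    moreover have "cs \<noteq> []" using cs(1) by (simp add: echain_def)
    ultimately show ?case using cs
      by (intro exI[of _ "cs @ [hclass E (xs @ [x])]"]) (simp add: echain_snoc)
  qed
qed

lemma chain_connected_chain_space_iff:
  assumes E: "E \<in> entourages"
  shows "chain_connected (chain_space b E) (chain_uniformity b E) \<longleftrightarrow>
    (\<forall>D\<in>entourages. D \<subseteq> E \<longrightarrow>
      (\<forall>c\<in>chain_space b E. \<exists>xs. echain D xs \<and> hd xs = b \<and> c = hclass E xs))"
proof (intro iffI ballI impI)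
  fix D c
  assume conn: "chain_connected (chain_space b E) (chain_uniformity b E)"
    and D: "D \<in> entourages" "D \<subseteq> E" and c: "c \<in> chain_space b E"
  have "hclass E [b] \<in> chain_space b E" by (simp add: hclass_in_chain_space)
  then obtain cs where "echain (star_entourage b E D) cs" "hd cs = hclass E [b]" "last cs = c"
    using conn[unfolded chain_connected_def, rule_format, OF star_entourage_on[OF E D] _ c] by blast
  then show "\<exists>xs. echain D xs \<and> hd xs = b \<and> c = hclass E xs"
    using star_chain_last[OF D(2)] by (auto simp: echain_def)
next
  assume refine: "\<forall>D\<in>entourages. D \<subseteq> E \<longrightarrow>
      (\<forall>c\<in>chain_space b E. \<exists>xs. echain D xs \<and> hd xs = b \<and> c = hclass E xs)"
  show "chain_connected (chain_space b E) (chain_uniformity b E)"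
    unfolding chain_connected_def
  proof (intro ballI)
    fix F p q
    assume F: "F \<in> entourages_on (chain_space b E) (chain_uniformity b E)"
      and p: "p \<in> chain_space b E" and q: "q \<in> chain_space b E"
    then obtain D where D: "D \<in> entourages" "D \<subseteq> E" "star_entourage b E D \<subseteq> F"
      using eventually_chain_uniformity[OF E, of "\<lambda>p. p \<in> F" b]
      by (auto simp: entourages_on_def)
    have from_base: "\<exists>cs. echain F cs \<and> hd cs = hclass E [b] \<and> last cs = c"
      if "c \<in> chain_space b E" for c
      using that refine D star_chain_of_echain[OF E D(2), of _ b] echain_mono[OF _ D(3)] by metis
    obtain cs where cs: "echain F cs" "hd cs = hclass E [b]" "last cs = p"
      using from_base[OF p] by blast
    obtain ds where ds: "echain F ds" "hd ds = hclass E [b]" "last ds = q"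
      using from_base[OF q] by blast
    have "cs \<noteq> []" using cs(1) by (simp add: echain_def)
    have "echain F (rev cs)" using F cs by (intro echain_rev) (auto simp: entourages_on_def)
    from echain_append[OF this ds(1)] \<open>cs \<noteq> []\<close> cs ds
    show "\<exists>xs. echain F xs \<and> hd xs = p \<and> last xs = q"
      by (intro exI[of _ "rev cs @ tl ds"]) (auto simp: hd_rev last_rev)
  qed
qed

text \<open>
  Chain connectedness of \<open>X\<^sub>E\<close> makes \<open>\<delta>\<^sub>D(X) \<rightarrow> \<delta>\<^sub>E(X)\<close> surjective, since end points of chains are
  not changed by homotopies.
\<close>

lemma trivial_deck_group_coarser:
  assumes E: "E \<in> entourages" and D: "D \<in> entourages" "D \<subseteq> E"
    and conn: "chain_connected (chain_space b E) (chain_uniformity b E)"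
    and triv: "trivial_group (deck_group b D)"
  shows "trivial_group (deck_group b E)"
  unfolding trivial_deck_group_iff[OF E]
proof (intro allI impI, elim conjE)
  fix xs assume xs: "echain E xs" "hd xs = b" "last xs = b"
  then obtain ys where ys: "echain D ys" "hd ys = b" "hclass E xs = hclass E ys"
    using chain_connected_chain_space_iff[OF E, THEN iffD1, OF conn, rule_format, OF D
        hclass_in_chain_space[OF xs(1,2)]] by blast
  then have hom: "homotopic E xs ys" by (simp add: hclass_eq_iff)
  then have "last ys = b" using homotopic_endpoints(2) xs by metis
  then have "homotopic D ys [b]" using triv ys by (simp add: trivial_deck_group_iff[OF D(1)])
  then show "homotopic E xs [b]"
    by (rule homotopic_trans[OF hom homotopic_mono[OF _ D(2)]])
qed

section \<open>The inverse limit\<close>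

lemma universal_coverD:
  assumes "x \<in> universal_cover b"
  shows "E \<in> entourages \<Longrightarrow> x E \<in> chain_space b E"
    and "D \<in> entourages \<Longrightarrow> E \<in> entourages \<Longrightarrow> D \<subseteq> E \<Longrightarrow> bonding E (x D) = x E"
  using assms by (auto simp: universal_cover_def entourage_limit_def)

lemma universal_cover_representative:
  assumes "x \<in> universal_cover b" "D \<in> entourages" "E \<in> entourages" "D \<subseteq> E"
  obtains xs where "echain D xs" "hd xs = b" "x D = hclass D xs" "x E = hclass E xs"
proof -
  obtain xs where xs: "echain D xs" "hd xs = b" "x D = hclass D xs"
    using universal_coverD(1)[OF assms(1,2)] by (rule chain_spaceE)
  then show ?thesis
    using that universal_coverD(2)[OF assms] bonding_hclass[OF assms(4)] by metis
qed

lemma endpoint_universal_cover: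
  assumes "x \<in> universal_cover b" "D \<in> entourages" "E \<in> entourages"
  shows "endpoint (x D) = endpoint (x E)"
proof -
  have "endpoint (x F) = endpoint (x UNIV)" if "F \<in> entourages" for F
    using universal_cover_representative[OF assms(1) that UNIV_entourage subset_UNIV]
    by (metis endpoint_hclass)
  then show ?thesis using assms by metis
qed

lemma limit_deck_group_carrier:
  "carrier (limit_deck_group b) = {x \<in> universal_cover b. \<forall>E\<in>entourages. endpoint (x E) = b}"
  by (auto simp: limit_deck_group_def universal_cover_def entourage_limit_def deck_group_carrier
      PiE_iff)

lemma limit_deck_group_one: "\<one>\<^bsub>limit_deck_group b\<^esub> = (\<lambda>E\<in>entourages. hclass E [b])"
  by (auto simp: limit_deck_group_def product_group_def deck_group_def)

lemma limit_deck_group_one_closed: "\<one>\<^bsub>limit_deck_group b\<^esub> \<in> carrier (limit_deck_group b)"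
proof -
  have "(\<lambda>E\<in>entourages. hclass E [b]) \<in> universal_cover b"
    unfolding universal_cover_def entourage_limit_def
    by (simp add: bonding_hclass hclass_in_chain_space)
  then show ?thesis by (simp add: limit_deck_group_one limit_deck_group_carrier)
qed

lemma trivial_limit_deck_group_iff:
  fixes b :: "'a::uniform_space"
  shows "trivial_group (limit_deck_group b) \<longleftrightarrow>
    (\<forall>x\<in>carrier (limit_deck_group b). \<forall>E\<in>entourages. x E = hclass E [b])"
proof
  assume "trivial_group (limit_deck_group b)"
  then have "carrier (limit_deck_group b) = {\<one>\<^bsub>limit_deck_group b\<^esub>}"
    by (simp add: trivial_group_def)
  then show "\<forall>x\<in>carrier (limit_deck_group b). \<forall>E\<in>entourages. x E = hclass E [b]"
    by (simp add: limit_deck_group_one)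
next
  let ?G = "limit_deck_group b"
  assume triv: "\<forall>x\<in>carrier ?G. \<forall>E\<in>entourages. x E = hclass E [b]"
  have "x = \<one>\<^bsub>?G\<^esub>" if x: "x \<in> carrier ?G" for x
  proof -
    have "x \<in> extensional entourages"
      using x by (auto simp: limit_deck_group_def entourage_limit_def PiE_iff)
    then show ?thesis
      unfolding limit_deck_group_one using x triv by (intro extensionalityI) auto
  qed
  then have carrier: "carrier ?G = {\<one>\<^bsub>?G\<^esub>}"
    using limit_deck_group_one_closed by blast
  have "hclass E [b] \<otimes>\<^bsub>deck_group b E\<^esub> hclass E [b] = hclass E [b]" for E
    using deck_group_mult[of E "[b]" "[b]" b] by simp
  then have "\<one>\<^bsub>?G\<^esub> \<otimes>\<^bsub>?G\<^esub> \<one>\<^bsub>?G\<^esub> = \<one>\<^bsub>?G\<^esub>"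
    unfolding limit_deck_group_one
    by (auto simp: limit_deck_group_def product_group_def fun_eq_iff)
  then have "group ?G"
    by (intro groupI) (auto simp: carrier)
  then show "trivial_group ?G" using carrier by (simp add: trivial_group_def)
qed

section \<open>Coverable spaces\<close>

lemma chain_connected_if_projection_onto:
  assumes E: "E \<in> entourages" and onto: "(\<lambda>x. x E) ` universal_cover b = chain_space b E"
  shows "chain_connected (chain_space b E) (chain_uniformity b E)"
  unfolding chain_connected_chain_space_iff[OF E]
proof (intro ballI impI)
  fix D c assume D: "D \<in> entourages" "D \<subseteq> E" and c: "c \<in> chain_space b E"
  obtain x where "x \<in> universal_cover b" "c = x E" using onto c by blast
  then show "\<exists>xs. echain D xs \<and> hd xs = b \<and> c = hclass E xs"
    using universal_cover_representative[OF _ D(1) E D(2)] by metis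
qed

text \<open>
  Every point of \<open>X\<close> is the end point of an \<open>X \<times> X\<close>-chain, hence it lies below a point of the
  inverse limit, whose coordinate at \<open>E\<close> provides an \<open>E\<close>-chain to it.
\<close>

lemma endpoint_onto_if_projection_onto:
  assumes E: "E \<in> entourages"
    and onto: "(\<lambda>x. x UNIV) ` universal_cover b = chain_space b UNIV"
  shows "endpoint ` chain_space b E = UNIV"
proof -
  have "y \<in> endpoint ` chain_space b E" for y
  proof -
    have "hclass UNIV [b, y] \<in> chain_space b UNIV"
      by (rule hclass_in_chain_space) (simp_all add: echain_def)
    then obtain x where x: "x \<in> universal_cover b" "hclass UNIV [b, y] = x UNIV"
      unfolding onto[symmetric] by blast
    have "endpoint (x E) = y"
      using endpoint_universal_cover[OF x(1) E UNIV_entourage] x(2)[symmetric] by simp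
    then show ?thesis using universal_coverD(1)[OF x(1) E] by blast
  qed
  then show ?thesis by blast
qed

text \<open>
  A point of the inverse limit that lifts the class of a loop belongs to \<open>\<delta>\<^sub>1(X)\<close>, as all its
  coordinates have the same end point.
\<close>

lemma trivial_deck_group_if_limit_trivial:
  assumes E: "E \<in> entourages" and onto: "(\<lambda>x. x E) ` universal_cover b = chain_space b E"
    and triv: "trivial_group (limit_deck_group b)"
  shows "trivial_group (deck_group b E)"
  unfolding trivial_deck_group_iff[OF E]
proof (intro allI impI, elim conjE)
  fix xs assume xs: "echain E xs" "hd xs = b" "last xs = b"
  then have "hclass E xs \<in> chain_space b E" by (intro hclass_in_chain_space)
  then obtain x where x: "x \<in> universal_cover b" "hclass E xs = x E"
    unfolding onto[symmetric] by blast
  have "endpoint (x D) = b" if "D \<in> entourages" for D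
    using endpoint_universal_cover[OF x(1) that E] x(2)[symmetric] xs(3) by simp
  then have "x \<in> carrier (limit_deck_group b)" using x(1) by (simp add: limit_deck_group_carrier)
  then have "x E = hclass E [b]" using triv E by (simp add: trivial_limit_deck_group_iff)
  then show "homotopic E xs [b]" using x(2) by (simp flip: hclass_eq_iff)
qed

lemma trivial_limit_if_trivial_on_base:
  fixes b :: "'a::uniform_space"
  assumes base: "entourage_base B" and triv: "\<And>E. E \<in> B \<Longrightarrow> trivial_group (deck_group b E)"
  shows "trivial_group (limit_deck_group b)"
  unfolding trivial_limit_deck_group_iff
proof (intro ballI)
  fix x and E :: "('a \<times> 'a) set"
  assume x: "x \<in> carrier (limit_deck_group b)" and E: "E \<in> entourages"
  obtain D where D: "D \<in> B" "D \<subseteq> E" "D \<in> entourages"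
    using base E unfolding entourage_base_def by blast
  have cover: "x \<in> universal_cover b" and loop: "endpoint (x D) = b"
    using x D(3) by (auto simp: limit_deck_group_carrier)
  obtain xs where xs: "echain D xs" "hd xs = b" "x D = hclass D xs" "x E = hclass E xs"
    using universal_cover_representative[OF cover D(3) E D(2)] .
  then have "homotopic D xs [b]"
    using triv[OF D(1)] loop by (simp add: trivial_deck_group_iff[OF D(3)])
  then show "x E = hclass E [b]"
    using xs(4) homotopic_mono[OF _ D(2)] by (simp add: hclass_eq_iff)
qed

theorem corollary50:
  fixes b :: "'a::uniform_space"
  assumes "coverable b"
  shows "(universal b \<longleftrightarrow>
           (\<forall>E\<in>entourages. chain_connected (chain_space b E) (chain_uniformity b E) \<longrightarrow>
              trivial_group (deck_group b E)))
       \<and> ((\<forall>E\<in>entourages. chain_connected (chain_space b E) (chain_uniformity b E) \<longrightarrow>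
              trivial_group (deck_group b E)) \<longleftrightarrow>
           trivial_group (limit_deck_group b))"
    (is "(_ \<longleftrightarrow> ?deck) \<and> (_ \<longleftrightarrow> ?limit)")
proof -
  obtain B where base: "entourage_base B" and "UNIV \<in> B"
    and covers: "\<forall>E\<in>B. (\<lambda>x. x E) ` universal_cover b = chain_space b E"
    using assms unfolding coverable_def by (elim exE conjE) (rule that)
  note onto = bspec[OF covers]
  have B: "E \<in> entourages" if "E \<in> B" for E using base that by (auto simp: entourage_base_def)
  have endpoint_onto: "endpoint ` chain_space b E = UNIV" if "E \<in> entourages" for E
    using endpoint_onto_if_projection_onto[OF that onto[OF \<open>UNIV \<in> B\<close>]] .
  have base_universal: "universal b" if "\<And>E. E \<in> B \<Longrightarrow> trivial_group (deck_group b E)"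
    unfolding universal_iff using base endpoint_onto[OF B] that
    by (intro exI[of _ B] conjI ballI)
  have deck_base: "trivial_group (deck_group b E)" if ?deck "E \<in> B" for E
    using that(1)[rule_format, OF B[OF that(2)]
        chain_connected_if_projection_onto[OF B[OF that(2)] onto[OF that(2)]]] .
  have universal_deck: ?deck if universal: "universal b"
  proof (intro ballI impI)
    fix E assume E: "E \<in> entourages"
      and conn: "chain_connected (chain_space b E) (chain_uniformity b E)"
    obtain C where C: "entourage_base C" "\<forall>D\<in>C. trivial_group (deck_group b D)"
      using universal unfolding universal_iff by blast
    then obtain D where "D \<in> entourages" "D \<subseteq> E" "trivial_group (deck_group b D)"
      using E unfolding entourage_base_def by blast
    then show "trivial_group (deck_group b E)"
      using trivial_deck_group_coarser[OF E _ _ conn] by blast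
  qed
  have limit_universal: "universal b" if ?limit
    using trivial_deck_group_if_limit_trivial[OF B onto that] by (rule base_universal)
  have deck_limit: ?limit if ?deck
    using trivial_limit_if_trivial_on_base[OF base deck_base[OF that]] .
  have deck_universal: "universal b" if ?deck
    using base_universal deck_base[OF that] .
  show ?thesis
    by (intro conjI iffI; (rule deck_universal universal_deck deck_limit
          universal_deck[OF limit_universal])?; assumption)
qed

end
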